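(* For all $d,\kappa\in\mathbb{N}^*$, $$\boldsymbol{\theta}_{0,\kappa}(\Delta):=\left\{\sum_{1\le q\le d}\cos(j_q\pi/\kappa):(j_1,\dots,j_d)\in\{0,\dots,\kappa\}^d\right\}\subset\boldsymbol{\Theta}_{0,\kappa}(\Delta).$$
   Context: $\mathbb{N}^*=\{1,2,\dots\}$. $\Delta$ is the discrete Laplacian $\sum_{i=1}^d\frac12(S_i+S_i^* )$ on $\ell^2(\mathbb{Z}^d)$, where $S_i$ is the unit shift in the $i$-th coordinate; its spectrum is $\sigma(\Delta)=[-d,d]$. Let $U_n$ be the Chebyshev polynomial of the second kind of degree $n$. For $\vec{x}=(x_1,\dots,x_d)\in[-1,1]^d$ and $j\in\mathbb{N}^*$ let $g_{j\kappa}(\vec{x})=\sum_{i=1}^d(1-x_i^2)U_{j\kappa-1}(x_i)$, and for $E\in\sigma(\Delta)$ let $S_E=\{\vec{x}\in[-1,1]^d:x_1+\dots+x_d=E\}$. By definition $E\in\boldsymbol{\Theta}_{0,\kappa}(\Delta)$ iff $E\in\sigma(\Delta)$ and there is $\vec{x}\in S_E$ with $g_{j\kappa}(\vec{x})=0$ for all $j\in\mathbb{N}^*$. *)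

theory Defs
  imports "HOL-Analysis.Analysis" "HOL-Computational_Algebra.Polynomial"
begin

text \<open>
  The dimension d is the cardinality of the finite index type \<open>'d\<close>, and \<open>int ^ 'd\<close> is the
  lattice of integer points. The library has no complex Hilbert space of square-summable
  functions, so operators on it are functions on \<open>int ^ 'd \<Rightarrow> complex\<close> that are only ever
  considered on the carrier set \<open>ell2\<close>.
\<close>

definition ell2 :: "(int ^ 'd \<Rightarrow> complex) set" where
  "ell2 = {f. (\<lambda>n. (cmod (f n))\<^sup>2) summable_on UNIV}"

definition ell2_norm :: "(int ^ 'd \<Rightarrow> complex) \<Rightarrow> real" where
  "ell2_norm f = sqrt (\<Sum>\<^sub>\<infinity>n. (cmod (f n))\<^sup>2)"

definition bounded_operator ::
    "((int ^ 'd \<Rightarrow> complex) \<Rightarrow> int ^ 'd \<Rightarrow> complex) \<Rightarrow> bool" where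
  "bounded_operator T \<longleftrightarrow>
     (\<forall>f\<in>ell2. T f \<in> ell2) \<and>
     (\<forall>f\<in>ell2. \<forall>g\<in>ell2. T (\<lambda>n. f n + g n) = (\<lambda>n. T f n + T g n)) \<and>
     (\<forall>c. \<forall>f\<in>ell2. T (\<lambda>n. c * f n) = (\<lambda>n. c * T f n)) \<and>
     (\<exists>C. \<forall>f\<in>ell2. ell2_norm (T f) \<le> C * ell2_norm f)"

definition resolvent_set ::
    "((int ^ 'd \<Rightarrow> complex) \<Rightarrow> int ^ 'd \<Rightarrow> complex) \<Rightarrow> complex set" where
  "resolvent_set T = {z. \<exists>R. bounded_operator R \<and>
     (\<forall>f\<in>ell2. R (\<lambda>n. T f n - z * f n) = f \<and> (\<lambda>n. T (R f) n - z * R f n) = f)}"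

definition spectrum ::
    "((int ^ 'd \<Rightarrow> complex) \<Rightarrow> int ^ 'd \<Rightarrow> complex) \<Rightarrow> complex set" where
  "spectrum T = - resolvent_set T"

definition shift :: "'d::finite \<Rightarrow> (int ^ 'd \<Rightarrow> complex) \<Rightarrow> int ^ 'd \<Rightarrow> complex" where
  "shift i f = (\<lambda>n. f (n - axis i 1))"

definition shift_adj :: "'d::finite \<Rightarrow> (int ^ 'd \<Rightarrow> complex) \<Rightarrow> int ^ 'd \<Rightarrow> complex" where
  "shift_adj i f = (\<lambda>n. f (n + axis i 1))"

text \<open>\<open>shift_adj i\<close> is the Hilbert space adjoint of \<open>shift i\<close>.\<close>

lemma shift_adj_adjoint:
  fixes f g :: "int ^ 'd::finite \<Rightarrow> complex"
  shows "(\<Sum>\<^sub>\<infinity>n. shift i f n * cnj (g n)) = (\<Sum>\<^sub>\<infinity>n. f n * cnj (shift_adj i g n))"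
proof -
  have "bij (\<lambda>n::int ^ 'd. n + axis i 1)"
    by (rule bij_betw_byWitness[where f' = "\<lambda>n. n - axis i 1"]) auto
  from infsum_reindex_bij_betw[OF this, of "\<lambda>n. shift i f n * cnj (g n)"]
  show ?thesis by (simp add: shift_def shift_adj_def)
qed

definition laplacian :: "(int ^ 'd::finite \<Rightarrow> complex) \<Rightarrow> int ^ 'd \<Rightarrow> complex" where
  "laplacian f = (\<lambda>n. \<Sum>i\<in>UNIV. 1 / 2 * (shift i f n + shift_adj i f n))"

fun chebyshev_U :: "nat \<Rightarrow> real poly" where
  "chebyshev_U 0 = 1"
| "chebyshev_U (Suc 0) = [:0, 2:]"
| "chebyshev_U (Suc (Suc n)) = [:0, 2:] * chebyshev_U (Suc n) - chebyshev_U n"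

text \<open>Only used for m at least 1, so the subtraction in the index does not truncate.\<close>

definition g_fun :: "nat \<Rightarrow> real ^ 'd::finite \<Rightarrow> real" where
  "g_fun m x = (\<Sum>i\<in>UNIV. (1 - (x $ i)\<^sup>2) * poly (chebyshev_U (m - 1)) (x $ i))"

definition energy_surface :: "real \<Rightarrow> (real ^ 'd::finite) set" where
  "energy_surface E = {x. (\<forall>i. x $ i \<in> {-1..1}) \<and> (\<Sum>i\<in>UNIV. x $ i) = E}"

text \<open>
  The two sets below are sets of real numbers, so the dimension is passed through a type token.
\<close>

definition Theta_thresholds :: "'d::finite itself \<Rightarrow> nat \<Rightarrow> real set" where
  "Theta_thresholds _ \<kappa> =
     {E. complex_of_real E \<in> spectrum (laplacian :: (int ^ 'd \<Rightarrow> complex) \<Rightarrow> _) \<and>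
         (\<exists>x \<in> (energy_surface E :: (real ^ 'd) set). \<forall>j\<ge>1. g_fun (j * \<kappa>) x = 0)}"

definition theta_thresholds :: "'d::finite itself \<Rightarrow> nat \<Rightarrow> real set" where
  "theta_thresholds _ \<kappa> =
     {\<Sum>q\<in>UNIV. cos (real (j q) * pi / real \<kappa>) | j :: 'd \<Rightarrow> nat. \<forall>q. j q \<in> {0..\<kappa>}}"

end

theory Submission
  imports Defs
begin

text \<open>
  A number \<open>E = \<Sum>\<^sub>q cos \<theta>\<^sub>q\<close> with \<open>\<theta>\<^sub>q = j\<^sub>q \<pi> / \<kappa>\<close> has to meet two conditions.

  The Chebyshev condition is met at the point \<open>x = (cos \<theta>\<^sub>1, \<dots>, cos \<theta>\<^sub>d)\<close>, which lies on the energy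
  surface of \<open>E\<close>. Since \<open>sin t \<cdot> U\<^sub>n(cos t) = sin ((n + 1) t)\<close>, the function with index \<open>m\<close> takes
  the value \<open>\<Sum>\<^sub>q sin \<theta>\<^sub>q sin (m \<theta>\<^sub>q)\<close> there (\<open>g_fun_cos\<close>), and for \<open>m = k \<kappa>\<close> every
  \<open>m \<theta>\<^sub>q = k j\<^sub>q \<pi>\<close> is a multiple of \<open>\<pi>\<close>.

  The spectral condition holds for arbitrary angles \<open>\<theta>\<^sub>q\<close> (\<open>sum_cos_in_spectrum_laplacian\<close>). The
  plane wave \<open>n \<mapsto> exp (i \<theta> \<cdot> n)\<close> satisfies the eigenvalue equation of the
  Laplacian for \<open>E\<close> but is not square-summable. Damped by the factor \<open>r\<close> to the power
  \<open>\<bar>n\<^sub>1\<bar> + \<dots> + \<bar>n\<^sub>d\<bar>\<close> with \<open>0 < r < 1\<close>, it becomes square-summable. A step to a neighbour in the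
  lattice changes the exponent by one, hence the damping by a relative amount of at most
  \<open>1 / r - 1\<close>. The defect in the eigenvalue equation is therefore at each single point at most
  \<open>d (1 / r - 1)\<close> times the modulus of the wave (\<open>laplacian_damped_wave\<close>), and the same bound
  passes to the norms. As \<open>r\<close> tends to 1 these are approximate eigenvectors, so \<open>E\<close> admits
  no bounded resolvent (\<open>approximate_eigenvalue_in_spectrum\<close>).
\<close>

section \<open>Square-summable functions and approximate eigenvectors\<close>

lemma ell2_dominated:
  fixes f g :: "int ^ 'd \<Rightarrow> complex"
  assumes f: "f \<in> ell2" and c: "c \<ge> 0" and le: "\<And>n. cmod (g n) \<le> c * cmod (f n)"
  shows "g \<in> ell2" "ell2_norm g \<le> c * ell2_norm f"
proof -
  have sf: "(\<lambda>n. c\<^sup>2 * (cmod (f n))\<^sup>2) summable_on UNIV"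
    using f by (auto simp: ell2_def intro: summable_on_cmult_right)
  have le2: "(cmod (g n))\<^sup>2 \<le> c\<^sup>2 * (cmod (f n))\<^sup>2" for n
    using power_mono[OF le, of n 2] by (simp add: power_mult_distrib)
  have sg: "(\<lambda>n. (cmod (g n))\<^sup>2) summable_on UNIV"
    by (rule summable_on_comparison_test[OF sf]) (use le2 in auto)
  then show "g \<in> ell2"
    by (simp add: ell2_def)
  have "(\<Sum>\<^sub>\<infinity>n. (cmod (g n))\<^sup>2) \<le> (\<Sum>\<^sub>\<infinity>n. c\<^sup>2 * (cmod (f n))\<^sup>2)"
    by (rule infsum_mono[OF sg sf]) (rule le2)
  also have "\<dots> = c\<^sup>2 * (\<Sum>\<^sub>\<infinity>n. (cmod (f n))\<^sup>2)"
    by (rule infsum_cmult_right')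
  finally have "sqrt (\<Sum>\<^sub>\<infinity>n. (cmod (g n))\<^sup>2) \<le> sqrt (c\<^sup>2 * (\<Sum>\<^sub>\<infinity>n. (cmod (f n))\<^sup>2))"
    by (rule real_sqrt_le_mono)
  then show "ell2_norm g \<le> c * ell2_norm f"
    using c by (simp add: ell2_norm_def real_sqrt_mult)
qed

lemma ell2_norm_pos:
  fixes f :: "int ^ 'd \<Rightarrow> complex"
  assumes f: "f \<in> ell2" and "f n \<noteq> 0"
  shows "ell2_norm f > 0"
proof -
  have "0 < (cmod (f n))\<^sup>2"
    using \<open>f n \<noteq> 0\<close> by simp
  also have "\<dots> = infsum (\<lambda>n. (cmod (f n))\<^sup>2) {n}"
    by simp
  also have "\<dots> \<le> (\<Sum>\<^sub>\<infinity>n. (cmod (f n))\<^sup>2)"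
    using f by (intro infsum_mono2) (auto simp: ell2_def)
  finally have "0 < (\<Sum>\<^sub>\<infinity>n. (cmod (f n))\<^sup>2)" .
  then show ?thesis
    by (simp add: ell2_norm_def)
qed

text \<open>
  Weyl's criterion, in the easy direction: a resolvent \<open>R\<close> would give
  \<open>\<parallel>f\<parallel> = \<parallel>R (T f - z f)\<parallel> \<le> C \<epsilon> \<parallel>f\<parallel>\<close>, which is absurd once \<open>C \<epsilon> < 1\<close>.
\<close>

lemma approximate_eigenvalue_in_spectrum:
  fixes T :: "(int ^ 'd \<Rightarrow> complex) \<Rightarrow> int ^ 'd \<Rightarrow> complex"
  assumes approx: "\<And>\<epsilon>. \<epsilon> > 0 \<Longrightarrow>
    \<exists>f\<in>ell2. ell2_norm f > 0 \<and> (\<lambda>n. T f n - z * f n) \<in> ell2 \<and>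
      ell2_norm (\<lambda>n. T f n - z * f n) \<le> \<epsilon> * ell2_norm f"
  shows "z \<in> spectrum T"
proof (rule ccontr)
  assume "z \<notin> spectrum T"
  then obtain R where R: "bounded_operator R"
    and inv: "\<And>f. f \<in> ell2 \<Longrightarrow> R (\<lambda>n. T f n - z * f n) = f"
    by (auto simp: spectrum_def resolvent_set_def)
  obtain C where C: "\<And>f. f \<in> ell2 \<Longrightarrow> ell2_norm (R f) \<le> C * ell2_norm f"
    using R unfolding bounded_operator_def by blast
  \<comment> \<open>\<open>C\<close> is an arbitrary real number, hence the absolute value; the 1 makes the product strictly less than 1\<close>
  define \<epsilon> where "\<epsilon> = 1 / (\<bar>C\<bar> + 1)"
  have \<epsilon>: "\<epsilon> > 0" "\<bar>C\<bar> * \<epsilon> < 1"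
    by (auto simp: \<epsilon>_def divide_simps)
  obtain f where f: "f \<in> ell2" "ell2_norm f > 0"
    and g: "(\<lambda>n. T f n - z * f n) \<in> ell2"
      "ell2_norm (\<lambda>n. T f n - z * f n) \<le> \<epsilon> * ell2_norm f"
    using approx[OF \<epsilon>(1)] by blast
  let ?g = "\<lambda>n. T f n - z * f n"
  have "ell2_norm ?g \<ge> 0"
    by (auto simp: ell2_norm_def intro!: infsum_nonneg)
  have "ell2_norm f = ell2_norm (R ?g)"
    using inv[OF f(1)] by simp
  also have "\<dots> \<le> C * ell2_norm ?g"
    by (rule C[OF g(1)])
  also have "\<dots> \<le> \<bar>C\<bar> * ell2_norm ?g"
    using \<open>ell2_norm ?g \<ge> 0\<close> by (intro mult_right_mono) auto
  also have "\<dots> \<le> \<bar>C\<bar> * (\<epsilon> * ell2_norm f)"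
    using g(2) by (intro mult_left_mono) auto
  also have "\<dots> < ell2_norm f"
    using mult_strict_right_mono[OF \<epsilon>(2) f(2)] by (simp add: mult.assoc)
  finally show False by simp
qed

section \<open>Damped plane waves\<close>

definition l1_length :: "int ^ 'd::finite \<Rightarrow> nat" where
  "l1_length n = (\<Sum>q\<in>UNIV. nat \<bar>n $ q\<bar>)"

definition damped_wave :: "real \<Rightarrow> ('d::finite \<Rightarrow> real) \<Rightarrow> int ^ 'd \<Rightarrow> complex" where
  "damped_wave r \<theta> n = cis (\<Sum>q\<in>UNIV. \<theta> q * of_int (n $ q)) * of_real (r ^ l1_length n)"

lemma norm_damped_wave: "r \<ge> 0 \<Longrightarrow> cmod (damped_wave r \<theta> n) = r ^ l1_length n"
  by (simp add: damped_wave_def norm_mult norm_power)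

lemma summable_on_power_nat_abs:
  fixes r :: real
  assumes "0 \<le> r" "r < 1"
  shows "(\<lambda>m::int. r ^ nat \<bar>m\<bar>) summable_on UNIV"
proof -
  have geo: "(\<lambda>k::nat. r ^ k) summable_on UNIV"
    using assms by (subst summable_on_UNIV_nonneg_real_iff) (auto intro: summable_geometric)
  have "(\<lambda>m::int. r ^ nat \<bar>m\<bar>) summable_on (int ` UNIV)"
    using geo by (subst summable_on_reindex) (auto simp: o_def inj_on_def)
  moreover have "(\<lambda>m::int. r ^ nat \<bar>m\<bar>) summable_on ((\<lambda>k. - int k) ` {1..})"
    using summable_on_subset_banach[OF geo, of "{1..}"]
    by (subst summable_on_reindex) (auto simp: o_def inj_on_def)
  ultimately have "(\<lambda>m::int. r ^ nat \<bar>m\<bar>) summable_on (int ` UNIV \<union> (\<lambda>k. - int k) ` {1..})"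
    by (rule summable_on_Un_disjoint) auto
  also have "int ` UNIV \<union> (\<lambda>k. - int k) ` {1..} = UNIV"
  proof -
    have "m \<in> int ` UNIV \<union> (\<lambda>k. - int k) ` {1..}" for m
      by (cases "m \<ge> 0") (auto intro: image_eqI[of _ _ "nat m"] image_eqI[of _ _ "nat (- m)"])
    then show ?thesis by blast
  qed
  finally show ?thesis .
qed

text \<open>
  The squared modulus is a product of one-dimensional geometric weights \<open>(r\<^sup>2)\<close> to the power \<open>\<bar>n\<^sub>q\<bar>\<close>,
  one for each coordinate, so its sum over the lattice factorises into convergent geometric series.
\<close>

lemma damped_wave_in_ell2:
  assumes "0 \<le> r" "r < 1"
  shows "damped_wave r (\<theta> :: 'd::finite \<Rightarrow> real) \<in> ell2"
proof -
  let ?w = "\<lambda>m::int. (r\<^sup>2) ^ nat \<bar>m\<bar>"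
  have r2: "0 \<le> r\<^sup>2" "r\<^sup>2 < 1"
    using assms by (auto simp: power_less_one_iff abs_square_less_1)
  have "Infinite_Set_Sum.abs_summable_on ?w UNIV"
    using summable_on_power_nat_abs[OF r2] r2(1)
    by (subst abs_summable_equivalent [symmetric]) (simp add: power_abs)
  then have "Infinite_Set_Sum.abs_summable_on
      (\<lambda>h::'d \<Rightarrow> int. \<Prod>q\<in>UNIV. ?w (h q)) (PiE UNIV (\<lambda>_. UNIV))"
    by (intro abs_summable_on_prod_PiE) auto
  then have "(\<lambda>h::'d \<Rightarrow> int. \<Prod>q\<in>UNIV. ?w (h q)) summable_on UNIV"
    unfolding PiE_UNIV_domain Pi_UNIV abs_summable_equivalent [symmetric]
    by (rule abs_summable_summable)
  moreover have "bij (\<lambda>n :: int ^ 'd. ($) n)"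
    by (rule bij_betw_byWitness[where f' = "\<lambda>h. \<chi> q. h q"]) auto
  ultimately have "(\<lambda>n :: int ^ 'd. \<Prod>q\<in>UNIV. ?w (n $ q)) summable_on UNIV"
    by (subst summable_on_reindex_bij_betw[of "\<lambda>n :: int ^ 'd. ($) n" UNIV UNIV
          "\<lambda>h. \<Prod>q\<in>UNIV. ?w (h q)"])
  also have "(\<lambda>n :: int ^ 'd. \<Prod>q\<in>UNIV. ?w (n $ q)) = (\<lambda>n. (cmod (damped_wave r \<theta> n))\<^sup>2)"
    using assms
    by (simp add: norm_damped_wave l1_length_def power_sum prod_power_distrib
        power_mult [symmetric] mult.commute)
  finally show ?thesis
    by (simp add: ell2_def)
qed

lemma l1_length_step:
  fixes n :: "int ^ 'd::finite"
  assumes "\<bar>s\<bar> = 1"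
  shows "l1_length (n + axis i s) \<le> l1_length n + 1"
proof -
  have "l1_length (n + axis i s) \<le> (\<Sum>q\<in>UNIV. nat \<bar>n $ q\<bar> + (if q = i then 1 else 0))"
    unfolding l1_length_def
    by (rule sum_mono) (use assms in \<open>auto simp: axis_def\<close>)
  then show ?thesis
    by (simp add: sum.distrib l1_length_def)
qed

text \<open>
  The worst case is \<open>a = b - 1\<close>, where equality holds; for \<open>a = b + 1\<close> the factor is \<open>1 - r\<close>,
  which is smaller.
\<close>

lemma power_diff_adjacent:
  fixes r :: real
  assumes r: "0 < r" "r \<le> 1" and "a \<le> b + 1" "b \<le> a + 1"
  shows "\<bar>r ^ a - r ^ b\<bar> \<le> (1 / r - 1) * r ^ b"
proof -
  consider "a = b" | "a = Suc b" | "b = Suc a"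
    using assms by linarith
  then show ?thesis
  proof cases
    case 1
    with r show ?thesis by simp
  next
    case 2
    have "1 - r \<le> 1 / r - 1"
    proof -
      have "0 \<le> (1 - r)\<^sup>2 / r" using r by simp
      also have "\<dots> = 1 / r - 1 - (1 - r)"
        using r by (simp add: field_simps power2_eq_square)
      finally show ?thesis by simp
    qed
    then have "(1 - r) * r ^ b \<le> (1 / r - 1) * r ^ b"
      using r by (intro mult_right_mono) auto
    moreover have "\<bar>r ^ a - r ^ b\<bar> = (1 - r) * r ^ b"
    proof -
      have "r ^ a - r ^ b = - ((1 - r) * r ^ b)"
        by (simp add: 2 algebra_simps)
      then show ?thesis using r by simp
    qed
    ultimately show ?thesis by simp
  next
    case 3
    have "r ^ a - r ^ b = (1 / r - 1) * r ^ b"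
      using r by (simp add: 3 field_simps)
    then show ?thesis using r by simp
  qed
qed

text \<open>
  Up to the damping, a unit step in direction \<open>i\<close> only multiplies the wave by a phase factor, so
  the difference is that of two adjacent powers of \<open>r\<close>.
\<close>

lemma damped_wave_shift:
  fixes \<theta> :: "'d::finite \<Rightarrow> real"
  assumes r: "0 < r" "r \<le> 1" and s: "\<bar>s\<bar> = 1"
  shows "cmod (damped_wave r \<theta> (n + axis i s) - cis (of_int s * \<theta> i) * damped_wave r \<theta> n)
    \<le> (1 / r - 1) * cmod (damped_wave r \<theta> n)"
proof -
  let ?phase = "\<lambda>n. \<Sum>q\<in>UNIV. \<theta> q * of_int (n $ q)"
  have "?phase (n + axis i s) = (\<Sum>q\<in>UNIV. \<theta> q * of_int (n $ q) + (if q = i then of_int s * \<theta> i else 0))"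
    by (rule sum.cong) (auto simp: axis_def algebra_simps)
  then have phase: "?phase (n + axis i s) = of_int s * \<theta> i + ?phase n"
    by (simp add: sum.distrib)
  have "damped_wave r \<theta> (n + axis i s) - cis (of_int s * \<theta> i) * damped_wave r \<theta> n
      = cis (of_int s * \<theta> i + ?phase n) * of_real (r ^ l1_length (n + axis i s) - r ^ l1_length n)"
    unfolding damped_wave_def phase by (simp add: algebra_simps flip: cis_mult)
  then have "cmod (damped_wave r \<theta> (n + axis i s) - cis (of_int s * \<theta> i) * damped_wave r \<theta> n)
      = \<bar>r ^ l1_length (n + axis i s) - r ^ l1_length n\<bar>"
    by (simp add: norm_mult del: of_real_diff of_real_power)
  also have "\<dots> \<le> (1 / r - 1) * r ^ l1_length n"
  proof (rule power_diff_adjacent[OF r])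
    show "l1_length (n + axis i s) \<le> l1_length n + 1"
      by (rule l1_length_step[OF s])
    have "n + axis i s + axis i (- s) = n"
      by (simp add: vec_eq_iff axis_def)
    then show "l1_length n \<le> l1_length (n + axis i s) + 1"
      using l1_length_step[of "- s" "n + axis i s" i] s by (simp only: abs_minus_cancel)
  qed
  finally show ?thesis
    using r by (simp add: norm_damped_wave)
qed

text \<open>
  The eigenvalue splits as \<open>cos \<theta>\<^sub>i = (cis \<theta>\<^sub>i + cis (- \<theta>\<^sub>i)) / 2\<close>, so that each of the \<open>2 d\<close>
  neighbours of \<open>n\<close> is compared with its own phase factor. That the bound is pointwise is what
  makes this damping convenient: no boundary terms have to be counted.
\<close>

lemma laplacian_damped_wave:
  fixes \<theta> :: "'d::finite \<Rightarrow> real"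
  assumes r: "0 < r" "r \<le> 1"
  shows "cmod (laplacian (damped_wave r \<theta>) n - of_real (\<Sum>q\<in>UNIV. cos (\<theta> q)) * damped_wave r \<theta> n)
    \<le> (real CARD('d) * (1 / r - 1)) * cmod (damped_wave r \<theta> n)"
proof -
  let ?f = "damped_wave r \<theta>"
  let ?D = "\<lambda>i s. ?f (n + axis i s) - cis (of_int s * \<theta> i) * ?f n"
  have cos: "complex_of_real (cos t) = (cis t + cis (- t)) / 2" for t
    by (simp add: complex_eq_iff)
  have ax: "n - axis i 1 = n + axis i (- 1)" for i
    by (simp add: vec_eq_iff axis_def)
  have "laplacian ?f n - of_real (\<Sum>q\<in>UNIV. cos (\<theta> q)) * ?f n
      = (\<Sum>i\<in>UNIV. 1 / 2 * (?f (n + axis i (- 1)) + ?f (n + axis i 1)) - of_real (cos (\<theta> i)) * ?f n)"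
    by (simp add: laplacian_def shift_def shift_adj_def ax sum_subtractf sum_distrib_right)
  also have "\<dots> = (\<Sum>i\<in>UNIV. 1 / 2 * (?D i (- 1) + ?D i 1))"
    by (rule sum.cong) (auto simp: cos field_simps)
  finally have eq: "laplacian ?f n - of_real (\<Sum>q\<in>UNIV. cos (\<theta> q)) * ?f n = \<dots>" .
  have "cmod (1 / 2 * (?D i (- 1) + ?D i 1)) \<le> (1 / r - 1) * cmod (?f n)" for i
  proof -
    have "cmod (1 / 2 * (?D i (- 1) + ?D i 1)) \<le> 1 / 2 * (cmod (?D i (- 1)) + cmod (?D i 1))"
      using norm_triangle_ineq[of "?D i (- 1)" "?D i 1"] by (simp add: norm_mult norm_divide)
    also have "\<dots> \<le> 1 / 2 * ((1 / r - 1) * cmod (?f n) + (1 / r - 1) * cmod (?f n))"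
      by (intro mult_left_mono add_mono damped_wave_shift[OF r]) auto
    finally show ?thesis
      by (simp only: mult_2 [symmetric])
  qed
  then have "cmod (\<Sum>i\<in>UNIV. 1 / 2 * (?D i (- 1) + ?D i 1))
      \<le> (\<Sum>i\<in>(UNIV :: 'd set). (1 / r - 1) * cmod (?f n))"
    by (rule sum_norm_le)
  then show ?thesis
    unfolding eq by (simp add: mult.assoc)
qed

theorem sum_cos_in_spectrum_laplacian:
  fixes \<theta> :: "'d::finite \<Rightarrow> real"
  shows "complex_of_real (\<Sum>q\<in>UNIV. cos (\<theta> q))
    \<in> spectrum (laplacian :: (int ^ 'd \<Rightarrow> complex) \<Rightarrow> _)" (is "?z \<in> _")
proof (rule approximate_eigenvalue_in_spectrum)
  fix \<epsilon> :: real
  assume "\<epsilon> > 0"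
  \<comment> \<open>the solution of \<open>d (1 / r - 1) = \<epsilon>\<close>\<close>
  define r where "r = 1 / (1 + \<epsilon> / real CARD('d))"
  have r: "0 < r" "r < 1" "real CARD('d) * (1 / r - 1) = \<epsilon>"
    using \<open>\<epsilon> > 0\<close> by (auto simp: r_def add_pos_pos)
  let ?f = "damped_wave r \<theta>"
  have f: "?f \<in> ell2"
    using r by (intro damped_wave_in_ell2) auto
  have "?f 0 \<noteq> 0"
    using r norm_damped_wave[of r \<theta> 0] by auto
  then have pos: "ell2_norm ?f > 0"
    by (rule ell2_norm_pos[OF f])
  have "cmod (laplacian ?f n - ?z * ?f n) \<le> \<epsilon> * cmod (?f n)" for n
    using laplacian_damped_wave[of r \<theta> n] r by simp
  note dominated = ell2_dominated[OF f less_imp_le[OF \<open>\<epsilon> > 0\<close>] this]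
  show "\<exists>f\<in>(ell2 :: (int ^ 'd \<Rightarrow> complex) set). ell2_norm f > 0 \<and>
      (\<lambda>n. laplacian f n - ?z * f n) \<in> ell2 \<and>
      ell2_norm (\<lambda>n. laplacian f n - ?z * f n) \<le> \<epsilon> * ell2_norm f"
    using f pos dominated by blast
qed

section \<open>Chebyshev polynomials at cosines\<close>

text \<open>
  The recurrence of the polynomials is the identity
  \<open>sin (a + t) = 2 cos t sin a - sin (a - t)\<close> with \<open>a\<close> a multiple of \<open>t\<close>.
\<close>

lemma sin_mult_chebyshev_U:
  "sin t * poly (chebyshev_U n) (cos t) = sin (real (Suc n) * t)"
proof (induction n rule: chebyshev_U.induct)
  case 1
  show ?case by simp
next
  case 2
  show ?case by (simp add: sin_double)
next
  case (3 n)
  have "sin t * poly (chebyshev_U (Suc (Suc n))) (cos t)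
      = 2 * cos t * (sin t * poly (chebyshev_U (Suc n)) (cos t)) - sin t * poly (chebyshev_U n) (cos t)"
    by (simp add: algebra_simps)
  also have "\<dots> = 2 * cos t * sin (real (Suc (Suc n)) * t) - sin (real (Suc n) * t)"
    by (simp only: 3)
  also have "\<dots> = sin (real (Suc (Suc n)) * t + t)"
  proof -
    have "sin (real (Suc n) * t) = sin (real (Suc (Suc n)) * t - t)"
      by (simp add: algebra_simps)
    then show ?thesis
      by (simp add: sin_add sin_diff)
  qed
  finally show ?case
    by (simp add: algebra_simps)
qed

text \<open>
  One factor \<open>sin\<close> of \<open>1 - cos\<^sup>2 = sin\<^sup>2\<close> clears the denominator of \<open>U\<^sub>m\<^sub>-\<^sub>1(cos t) = sin (m t) / sin t\<close>,
  which makes the formula valid also where \<open>sin t = 0\<close>. The summands vanish separately as soon as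
  every \<open>m \<theta>\<^sub>q\<close> is a multiple of \<open>\<pi>\<close>.
\<close>

lemma g_fun_cos:
  assumes "m \<ge> 1"
  shows "g_fun m (\<chi> q. cos (\<theta> q)) = (\<Sum>q\<in>UNIV. sin (\<theta> q) * sin (real m * \<theta> q))"
proof -
  have "(1 - (cos t)\<^sup>2) * poly (chebyshev_U (m - 1)) (cos t) = sin t * sin (real m * t)" for t
  proof -
    have "(1 - (cos t)\<^sup>2) * poly (chebyshev_U (m - 1)) (cos t)
        = sin t * (sin t * poly (chebyshev_U (m - 1)) (cos t))"
      unfolding cos_squared_eq by (simp add: power2_eq_square)
    with assms show ?thesis
      by (simp add: sin_mult_chebyshev_U)
  qed
  then show ?thesis
    by (simp add: g_fun_def)
qed

section \<open>Thresholds\<close>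

theorem lemma1p4:
  fixes \<kappa> :: nat
  assumes "\<kappa> \<ge> 1"
  shows "theta_thresholds TYPE('d::finite) \<kappa> \<subseteq> Theta_thresholds TYPE('d) \<kappa>"
proof
  fix E
  assume "E \<in> theta_thresholds TYPE('d) \<kappa>"
  then obtain j :: "'d \<Rightarrow> nat" where E: "E = (\<Sum>q\<in>UNIV. cos (real (j q) * pi / real \<kappa>))"
    by (auto simp: theta_thresholds_def)
  define \<theta> where "\<theta> q = real (j q) * pi / real \<kappa>" for q
  have "g_fun (k * \<kappa>) (\<chi> q. cos (\<theta> q)) = 0" if "k \<ge> 1" for k
  proof -
    have "sin (real (k * \<kappa>) * \<theta> q) = 0" for q
    proof -
      have "real (k * \<kappa>) * \<theta> q = real (k * j q) * pi"
        using assms by (simp add: \<theta>_def)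
      then show ?thesis
        by (simp only: sin_npi)
    qed
    with that assms show ?thesis
      by (simp add: g_fun_cos)
  qed
  moreover have "(\<chi> q. cos (\<theta> q)) \<in> energy_surface E"
    by (simp add: energy_surface_def E \<theta>_def)
  ultimately show "E \<in> Theta_thresholds TYPE('d) \<kappa>"
    using sum_cos_in_spectrum_laplacian[of \<theta>]
    by (auto simp: Theta_thresholds_def E \<theta>_def)
qed

end
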